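(* Let $1<\alpha<2$ and let $X^d=(X_1,\dots,X_d)$ be a complex (resp. real) symmetric $\alpha$-stable random vector with spectral measure $\Gamma_{X^d}$, and let $\phi$ be the Fourier transform of $\Gamma_{X^d}$. Suppose that for all $i,j,k\in\{1,\dots,d\}$ not all equal, $$\frac{\partial^3\phi}{\overline{\partial}\theta_i\,\overline{\partial}\theta_j\,\overline{\partial}\theta_k}(\theta_1,\dots,\theta_d)=0\qquad\text{for all }\theta_1,\dots,\theta_d\in\mathbb{C}\ (\text{resp. }\mathbb{R}).$$ Then the covariation is additive with respect to its second variable, i.e. for all $i_0\in\{1,\dots,d\}$ and all $\theta_1,\dots,\theta_d\in\mathbb{C}$ (resp. $\mathbb{R}$), $$[X_{i_0},\theta_1X_1+\dots+\theta_dX_d]_{\alpha}=[X_{i_0},\theta_1X_1]_{\alpha}+\dots+[X_{i_0},\theta_dX_d]_{\alpha}.$$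
   Context: A real random vector $(X_1,\dots,X_d)$ is symmetric $\alpha$-stable (S$\alpha$S) if its characteristic function is $\exp\{-\int_{\mathbb{S}_d}|\sum_{i=1}^d t_is_i|^{\alpha}\,d\Gamma(s_1,\dots,s_d)\}$ for a (unique) finite symmetric measure $\Gamma=\Gamma_{X^d}$ on the unit sphere $\mathbb{S}_d$ of $\mathbb{R}^d$, called its spectral measure. A complex vector $X^d$ with $X_j=X_j^1+\imath X_j^2$ is S$\alpha$S if the real vector $(X_1^1,X_1^2,\dots,X_d^1,X_d^2)$ is S$\alpha$S; then $\Gamma_{X^d}$ denotes the spectral measure of this real vector, a measure on the unit sphere $\mathbb{S}_{2d}$ of $\mathbb{R}^{2d}$, whose points are written $(s_1^1,s_1^2,\dots,s_d^1,s_d^2)$ with $s_j=s_j^1+\imath s_j^2$. For $z\in\mathbb{C}$ and $\beta>0$, $z^{<\beta>}=|z|^{\beta-1}\overline{z}$ (with $0^{<\beta>}=0$); for real $s$ this is $\mathrm{sign}(s)|s|^{\beta}$. The covariation of $X_1$ on $X_2$ is $[X_1,X_2]_{\alpha}=\int s_1s_2^{<\alpha-1>}\,d\Gamma_{(X_1,X_2)}$, where the integral is over $\mathbb{S}_2$ in the real case, and over $\mathbb{S}_4$ with $s_j=s_j^1+\imath s_j^2$ in the complex case. The Fourier transform of $\Gamma_{X^d}$ is $\phi(\theta)=\int_{\mathbb{S}_d}\cos(\sum_{i=1}^d\theta_is_i)\,d\Gamma_{X^d}$, $\theta\in\mathbb{R}^d$, in the real case, and $\phi(\theta)=\int_{\mathbb{S}_{2d}}\cos(\mathrm{Re}\sum_{i=1}^d\theta_i\overline{s_i})\,d\Gamma_{X^d}$,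 $\theta\in\mathbb{C}^d$, in the complex case. For $\theta_j=\theta_j^1+\imath\theta_j^2$ the operator is $\frac{\partial}{\overline{\partial}\theta_j}=\frac{\partial}{\partial\theta_j^1}+\imath\frac{\partial}{\partial\theta_j^2}$; when the $\theta_j$ are real (real case) it is the usual partial derivative. *)

theory Defs
  imports "HOL-Probability.Probability"
begin

text \<open>
  Random vectors take values in an arbitrary Euclidean space. For \<^typ>\<open>complex^'n\<close> and
  \<^typ>\<open>complex \<times> complex\<close> the inner product and norm are those of the underlying real
  vector of real and imaginary parts, so the unit sphere of \<^typ>\<open>complex^'n\<close> is the unit
  sphere of $\mathbf{R}^{2d}$, and the definitions below cover the real and the complex case.
\<close>

definition is_spectral_measure ::
    "real \<Rightarrow> 'a measure \<Rightarrow> ('a \<Rightarrow> 'b::euclidean_space) \<Rightarrow> 'b measure \<Rightarrow> bool" where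
  "is_spectral_measure \<alpha> M X \<Gamma> \<longleftrightarrow>
     sets \<Gamma> = sets (restrict_space borel (sphere 0 1)) \<and>
     finite_measure \<Gamma> \<and>
     (\<forall>A\<in>sets \<Gamma>. emeasure \<Gamma> (uminus ` A) = emeasure \<Gamma> A) \<and>
     (\<forall>t. (CLINT \<omega>|M. iexp (t \<bullet> X \<omega>)) =
          complex_of_real (exp (- (LINT s|\<Gamma>. \<bar>t \<bullet> s\<bar> powr \<alpha>))))"

definition symmetric_stable :: "real \<Rightarrow> 'a measure \<Rightarrow> ('a \<Rightarrow> 'b::euclidean_space) \<Rightarrow> bool" where
  "symmetric_stable \<alpha> M X \<longleftrightarrow>
     X \<in> borel_measurable M \<and> (\<exists>\<Gamma>. is_spectral_measure \<alpha> M X \<Gamma>)"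

text \<open>
  For $0 < \alpha < 2$ the spectral measure of a symmetric stable vector is unique, so the
  choice below picks out that measure.
\<close>

definition spectral_measure ::
    "real \<Rightarrow> 'a measure \<Rightarrow> ('a \<Rightarrow> 'b::euclidean_space) \<Rightarrow> 'b measure" where
  "spectral_measure \<alpha> M X = (SOME \<Gamma>. is_spectral_measure \<alpha> M X \<Gamma>)"

definition signed_power_complex :: "complex \<Rightarrow> real \<Rightarrow> complex" where
  "signed_power_complex z \<beta> = complex_of_real (cmod z powr (\<beta> - 1)) * cnj z"

definition signed_power_real :: "real \<Rightarrow> real \<Rightarrow> real" where
  "signed_power_real s \<beta> = sgn s * \<bar>s\<bar> powr \<beta>"

definition covariation_complex ::
    "real \<Rightarrow> 'a measure \<Rightarrow> ('a \<Rightarrow> complex) \<Rightarrow> ('a \<Rightarrow> complex) \<Rightarrow> complex" where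
  "covariation_complex \<alpha> M X\<^sub>1 X\<^sub>2 =
     (CLINT s|spectral_measure \<alpha> M (\<lambda>\<omega>. (X\<^sub>1 \<omega>, X\<^sub>2 \<omega>)).
        fst s * signed_power_complex (snd s) (\<alpha> - 1))"

definition covariation_real ::
    "real \<Rightarrow> 'a measure \<Rightarrow> ('a \<Rightarrow> real) \<Rightarrow> ('a \<Rightarrow> real) \<Rightarrow> real" where
  "covariation_real \<alpha> M X\<^sub>1 X\<^sub>2 =
     (LINT s|spectral_measure \<alpha> M (\<lambda>\<omega>. (X\<^sub>1 \<omega>, X\<^sub>2 \<omega>)).
        fst s * signed_power_real (snd s) (\<alpha> - 1))"

definition fourier_complex :: "(complex^'n) measure \<Rightarrow> complex^'n \<Rightarrow> real" where
  "fourier_complex \<Gamma> \<theta> = (LINT s|\<Gamma>. cos (Re (\<Sum>i\<in>UNIV. \<theta> $ i * cnj (s $ i))))"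

definition fourier_real :: "(real^'n) measure \<Rightarrow> real^'n \<Rightarrow> real" where
  "fourier_real \<Gamma> \<theta> = (LINT s|\<Gamma>. cos (\<Sum>i\<in>UNIV. \<theta> $ i * s $ i))"

text \<open>
  The operator $\partial/\partial\theta_j^1 + \imath\,\partial/\partial\theta_j^2$, without the
  customary factor $1/2$. It is only applied to the smooth function \<^const>\<open>fourier_complex\<close>
  of a finite measure on the sphere and to its derivatives, so all partial derivatives exist.
\<close>

definition dbar :: "'n::finite \<Rightarrow> (complex^'n \<Rightarrow> complex) \<Rightarrow> complex^'n \<Rightarrow> complex" where
  "dbar j f \<theta> =
     vector_derivative (\<lambda>t::real. f (\<theta> + axis j (complex_of_real t))) (at 0) +
     \<i> * vector_derivative (\<lambda>t::real. f (\<theta> + axis j (\<i> * complex_of_real t))) (at 0)"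

definition partial_deriv :: "'n::finite \<Rightarrow> (real^'n \<Rightarrow> real) \<Rightarrow> real^'n \<Rightarrow> real" where
  "partial_deriv j f \<theta> = deriv (\<lambda>t. f (\<theta> + axis j t)) 0"

end

theory Submission
  imports Defs
begin

text \<open>
  The vanishing of the mixed third derivatives of the Fourier transform forces
  $s_i s_j = 0$ almost everywhere with respect to the spectral measure whenever $i \neq j$, so
  that almost every $s$ has at most one nonzero coordinate and
  $(\sum_j \theta_j s_j)^{<\alpha-1>} = \sum_j (\theta_j s_j)^{<\alpha-1>}$. It remains to compute
  covariations of linear images $(p(X), q(X))$ as integrals against the spectral measure of $X$
  itself. This needs no uniqueness of spectral measures: the characteristic function determines
  $\int |a \cdot s_1 + b \cdot s_2|^\alpha$ for all $a, b$, hence, by averaging over rotations in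
  the complex case, $\int |s_2 + c s_1|^\alpha$ for all scalars $c$, and its derivative at $c = 0$
  is a multiple of the covariation.
\<close>

section \<open>Differentiation\<close>

text \<open>The covariation refers to the spectral measure of a pair, obtained by a choice that says
  nothing unless some spectral measure exists; hence the explicit pushforward for linear images.
  After that only the exponents of characteristic functions can be compared, so the signed power,
  which is not the \<alpha>-th power of a linear form, has to be reached by differentiating one. The
  derivative \<alpha> |w|^(\<alpha>-2) (w \<bullet> z) of |w + t z|^\<alpha> at t = 0 remains
  correct where w = 0 because 1 < \<alpha>. In the complex case the exponents involve only real
  parts of complex linear combinations, whereas the covariation needs moduli; this is what the
  rotations repair. On the Fourier side, further differentiation takes the place of injectivity of
  the Fourier transform: six derivatives turn the integrand at the origin into the negative of a
  square.\<close>

lemma has_vector_derivative_integral: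
  fixes f :: "real \<Rightarrow> 'a \<Rightarrow> 'c::{banach,second_countable_topology}"
  assumes f: "\<And>t. integrable N (f t)"
    and f': "f' \<in> borel_measurable N"
    and deriv: "\<And>s. s \<in> space N \<Longrightarrow> ((\<lambda>t. f t s) has_vector_derivative f' s) (at 0)"
    and K: "integrable N K"
    and lip: "\<And>t s. s \<in> space N \<Longrightarrow> \<bar>t\<bar> \<le> 1 \<Longrightarrow> norm (f t s - f 0 s) \<le> K s * \<bar>t\<bar>"
  shows "((\<lambda>t. LINT s|N. f t s) has_vector_derivative (LINT s|N. f' s)) (at 0)" (is ?D)
    and "integrable N f'" (is ?I)
proof -
  \<comment> \<open>The domination hypothesis covers only |t| \<le> 1. As 0 is interior to this
    interval, the limit may be taken along sequences inside it, where dominated convergence applies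
    to the difference quotients.\<close>
  have at0: "at (0::real) = at 0 within {-1..1}"
    by (rule at_within_interior[symmetric]) simp
  have quot: "(g has_vector_derivative D) (at (0::real)) \<longleftrightarrow>
      ((\<lambda>h. (g h - g 0) /\<^sub>R h) \<longlongrightarrow> D) (at 0)" for g :: "real \<Rightarrow> 'c" and D
  proof -
    have "((\<lambda>h. (g h - g 0) /\<^sub>R h) \<longlongrightarrow> D) (at 0) \<longleftrightarrow>
        ((\<lambda>h. norm ((g h - g 0) /\<^sub>R h - D)) \<longlongrightarrow> 0) (at 0)"
      by (simp add: tendsto_norm_zero_iff LIM_zero_iff)
    also have "\<dots> \<longleftrightarrow> ((\<lambda>h. norm (g h - g 0 - h *\<^sub>R D) / norm h) \<longlongrightarrow> 0) (at 0)"
    proof (rule tendsto_cong)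
      have "norm ((g h - g 0) /\<^sub>R h - D) = norm (g h - g 0 - h *\<^sub>R D) / norm h" if "h \<noteq> 0" for h
      proof -
        have "(g h - g 0) /\<^sub>R h - D = (g h - g 0 - h *\<^sub>R D) /\<^sub>R h"
          using that by (simp add: scaleR_diff_right)
        then show ?thesis by (simp add: divide_inverse mult.commute)
      qed
      then show "\<forall>\<^sub>F h in at 0. norm ((g h - g 0) /\<^sub>R h - D) = norm (g h - g 0 - h *\<^sub>R D) / norm h"
        by (simp add: eventually_at_filter)
    qed
    finally show ?thesis
      by (simp add: has_vector_derivative_def has_derivative_iff_norm bounded_linear_scaleR_left)
  qed
  have dom: "integrable N f' \<and> (\<lambda>i. LINT s|N. (f (X i) s - f 0 s) /\<^sub>R X i) \<longlonglongrightarrow> (LINT s|N. f' s)"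
    if X: "\<And>i. X i \<in> {-1..1} - {0}" "X \<longlonglongrightarrow> 0" for X :: "nat \<Rightarrow> real"
  proof (intro conjI)
    have lim: "AE s in N. (\<lambda>i. (f (X i) s - f 0 s) /\<^sub>R X i) \<longlonglongrightarrow> f' s"
    proof (rule AE_I2)
      fix s assume "s \<in> space N"
      from deriv[OF this] have "((\<lambda>h. (f h s - f 0 s) /\<^sub>R h) \<longlongrightarrow> f' s) (at 0 within {-1..1})"
        by (simp add: quot flip: at0)
      with X show "(\<lambda>i. (f (X i) s - f 0 s) /\<^sub>R X i) \<longlonglongrightarrow> f' s"
        by (simp add: tendsto_at_iff_sequentially comp_def)
    qed
    have bnd: "AE s in N. norm ((f (X i) s - f 0 s) /\<^sub>R X i) \<le> K s" for i
    proof (rule AE_I2)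
      fix s assume s: "s \<in> space N"
      have "X i \<noteq> 0" "\<bar>X i\<bar> \<le> 1" using X(1)[of i] by auto
      with lip[OF s, of "X i"] show "norm ((f (X i) s - f 0 s) /\<^sub>R X i) \<le> K s"
        by (simp add: divide_simps mult.commute)
    qed
    have m: "(\<lambda>s. (f (X i) s - f 0 s) /\<^sub>R X i) \<in> borel_measurable N" for i
      using f by (intro borel_measurable_scaleR borel_measurable_diff) auto
    show "integrable N f'"
      by (rule integrable_dominated_convergence[OF f' m K lim bnd])
    show "(\<lambda>i. LINT s|N. (f (X i) s - f 0 s) /\<^sub>R X i) \<longlonglongrightarrow> (LINT s|N. f' s)"
      by (rule integral_dominated_convergence[OF f' m K lim bnd])
  qed
  have eq: "(LINT s|N. (f t s - f 0 s) /\<^sub>R t) = ((LINT s|N. f t s) - (LINT s|N. f 0 s)) /\<^sub>R t" for t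
    using f by simp
  have "((\<lambda>h. ((LINT s|N. f h s) - (LINT s|N. f 0 s)) /\<^sub>R h) \<longlongrightarrow> (LINT s|N. f' s)) (at 0 within {-1..1})"
    unfolding tendsto_at_iff_sequentially comp_def
    using dom unfolding eq by blast
  then show ?D
    unfolding quot by (simp flip: at0)
  \<comment> \<open>Integrability of \<open>f'\<close> comes out of dominated convergence along any
    admissible sequence; 1/(n+1) is one.\<close>
  have "(\<lambda>i. inverse (real (Suc i))) \<longlonglongrightarrow> 0" by (rule LIMSEQ_inverse_real_of_nat)
  then show ?I
    using dom[of "\<lambda>i. inverse (real (Suc i))"] by (auto simp: field_simps)
qed

text \<open>Away from w = 0 the chain rule applies. At w = 0 the difference quotient has absolute
  value |h|^(\<alpha>-1) |z|^\<alpha>, which tends to 0 since 1 < \<alpha>, in agreement with the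
  formula.\<close>

lemma norm_powr_line_has_derivative:
  fixes w z :: "'c::real_inner"
  assumes \<alpha>: "1 < \<alpha>"
  shows "((\<lambda>t. norm (w + t *\<^sub>R z) powr \<alpha>) has_real_derivative
      \<alpha> * (norm w powr (\<alpha> - 2) * (w \<bullet> z))) (at 0)"
proof (cases "w = 0")
  case True
  have "((\<lambda>h. norm h powr (\<alpha> - 1) * norm z powr \<alpha>) \<longlongrightarrow> 0 powr (\<alpha> - 1) * norm z powr \<alpha>) (at (0::real))"
    using \<alpha> by (intro tendsto_mult tendsto_const tendsto_powr') (auto intro!: tendsto_eq_intros)
  then have lim: "((\<lambda>h. norm h powr (\<alpha> - 1) * norm z powr \<alpha>) \<longlongrightarrow> 0) (at (0::real))"
    by simp
  have "((\<lambda>h. norm (h *\<^sub>R z) powr \<alpha> / h) \<longlongrightarrow> 0) (at (0::real))"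
    by (rule Lim_null_comparison[OF _ lim])
      (auto simp: eventually_at_filter powr_mult powr_diff field_simps intro!: always_eventually)
  then show ?thesis using True by (simp add: DERIV_def)
next
  case False
  \<comment> \<open>The squared norm is a quadratic polynomial in t, positive at t = 0, so its power
    \<alpha>/2 can be differentiated there.\<close>
  have sq: "norm v powr \<alpha> = (v \<bullet> v) powr (\<alpha>/2)" for v :: 'c
    by (simp add: dot_square_norm powr_powr flip: powr_numeral)
  have "((\<lambda>t. ((w + t *\<^sub>R z) \<bullet> (w + t *\<^sub>R z)) powr (\<alpha>/2)) has_real_derivative
      \<alpha> * (norm w powr (\<alpha> - 2) * (w \<bullet> z))) (at 0)"
  proof -
    have "((\<lambda>t. w \<bullet> w + 2 * t * (w \<bullet> z) + t\<^sup>2 * (z \<bullet> z)) has_real_derivative 2 * (w \<bullet> z)) (at 0)"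
      by (auto intro!: derivative_eq_intros)
    from DERIV_fun_powr[OF this, of "\<alpha>/2"] False
    have "((\<lambda>t. (w \<bullet> w + 2 * t * (w \<bullet> z) + t\<^sup>2 * (z \<bullet> z)) powr (\<alpha>/2)) has_real_derivative
        \<alpha>/2 * (w \<bullet> w) powr (\<alpha>/2 - 1) * (2 * (w \<bullet> z))) (at 0)"
      by simp
    moreover have "(w \<bullet> w) powr (\<alpha>/2 - 1) = norm w powr (\<alpha> - 2)"
      by (simp add: dot_square_norm powr_powr right_diff_distrib flip: powr_numeral)
    ultimately show ?thesis
      by (simp add: inner_add_left inner_add_right inner_commute power2_eq_square algebra_simps)
  qed
  then show ?thesis by (simp only: sq)
qed

text \<open>Mean value inequality: the derivative \<alpha> u^(\<alpha>-1) increases on [0, R], so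
  its value at R bounds it.\<close>

lemma powr_diff_le:
  fixes x y :: real
  assumes "1 < \<alpha>" and "0 \<le> x" "x \<le> R" "0 \<le> y" "y \<le> R"
  shows "\<bar>x powr \<alpha> - y powr \<alpha>\<bar> \<le> \<alpha> * R powr (\<alpha> - 1) * \<bar>x - y\<bar>"
proof -
  have "norm (x powr \<alpha> - y powr \<alpha>) \<le> \<alpha> * R powr (\<alpha> - 1) * norm (x - y)"
  proof (rule field_differentiable_bound[of "{0..R}" "\<lambda>x. x powr \<alpha>" "\<lambda>x. \<alpha> * x powr (\<alpha> - 1)"])
    fix u :: real assume u: "u \<in> {0..R}"
    show "norm (\<alpha> * u powr (\<alpha> - 1)) \<le> \<alpha> * R powr (\<alpha> - 1)"
      using u assms by (simp add: abs_mult powr_mono2)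
    show "((\<lambda>x. x powr \<alpha>) has_real_derivative \<alpha> * u powr (\<alpha> - 1)) (at u within {0..R})"
    proof (cases "u = 0")
      case True
      \<comment> \<open>The power rule asks for a positive base, so at 0 the derivative of
        |t|^\<alpha> is used and restricted to one side.\<close>
      have "((\<lambda>t. norm (0 + t *\<^sub>R (1::real)) powr \<alpha>) has_real_derivative 0) (at 0)"
        using norm_powr_line_has_derivative[of \<alpha> "0::real" 1] assms by simp
      then have "((\<lambda>t. \<bar>t\<bar> powr \<alpha>) has_real_derivative 0) (at 0 within {0..R})"
        by (auto intro: DERIV_subset)
      then show ?thesis
        using True assms u by (auto elim!: has_field_derivative_transform_within[where d=1])
    next
      case False
      then show ?thesis using u assms
        by (auto intro!: derivative_eq_intros simp: powr_diff)
    qed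
  qed (use assms in auto)
  then show ?thesis by simp
qed

section \<open>Integrals against finite measures on the sphere\<close>

text \<open>Compactness of the sphere makes continuous functions bounded, hence integrable for a
  finite measure; the domination arguments below rest on this.\<close>

locale sphere_measure = finite_measure \<Gamma> for \<Gamma> :: "'b::euclidean_space measure" +
  assumes sets_sphere: "sets \<Gamma> = sets (restrict_space borel (sphere 0 1))"
begin

lemma space_sphere: "space \<Gamma> = sphere 0 1"
  using sets_eq_imp_space_eq[OF sets_sphere] by (simp add: space_restrict_space)

lemma measurable_continuous_sphere:
  fixes f :: "'b \<Rightarrow> 'c::topological_space"
  assumes "continuous_on (sphere 0 1) f"
  shows "f \<in> borel_measurable \<Gamma>"
  unfolding measurable_cong_sets[OF sets_sphere refl]
  using assms by (rule borel_measurable_continuous_on_restrict)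

lemma bounded_continuous_sphere:
  fixes f :: "'b \<Rightarrow> 'c::real_normed_vector"
  assumes "continuous_on (sphere 0 1) f"
  obtains B where "0 < B" "\<And>s. s \<in> space \<Gamma> \<Longrightarrow> norm (f s) \<le> B"
  using compact_imp_bounded[OF compact_continuous_image[OF assms compact_sphere]]
  unfolding bounded_pos space_sphere by (auto simp: image_iff)

lemma integrable_continuous_sphere:
  fixes f :: "'b \<Rightarrow> 'c::{banach,second_countable_topology}"
  assumes "continuous_on (sphere 0 1) f"
  shows "integrable \<Gamma> f"
proof -
  obtain B where "0 < B" "\<And>s. s \<in> space \<Gamma> \<Longrightarrow> norm (f s) \<le> B"
    using bounded_continuous_sphere[OF assms] by blast
  then show ?thesis
    by (intro integrable_const_bound[where B=B] measurable_continuous_sphere assms AE_I2)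
qed

text \<open>The phase \<open>p\<close> turns differentiation into a shift by pi/2, so iterated
  derivatives keep one shape instead of alternating between sine and cosine. Domination holds
  because cos is 1-Lipschitz.\<close>

lemma cos_integral_has_vector_derivative:
  fixes g :: "'b \<Rightarrow> 'c::{banach,second_countable_topology}"
  assumes g: "continuous_on (sphere 0 1) g"
  shows "((\<lambda>t. LINT s|\<Gamma>. cos ((\<theta> + t *\<^sub>R a) \<bullet> s + p) *\<^sub>R g s) has_vector_derivative
     (LINT s|\<Gamma>. cos (\<theta> \<bullet> s + (p + pi/2)) *\<^sub>R (a \<bullet> s) *\<^sub>R g s)) (at 0)"
proof (rule has_vector_derivative_integral)
  show "integrable \<Gamma> (\<lambda>s. cos ((\<theta> + t *\<^sub>R a) \<bullet> s + p) *\<^sub>R g s)" for t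
    by (intro integrable_continuous_sphere continuous_intros g)
  show "(\<lambda>s. cos (\<theta> \<bullet> s + (p + pi/2)) *\<^sub>R (a \<bullet> s) *\<^sub>R g s) \<in> borel_measurable \<Gamma>"
    by (intro measurable_continuous_sphere continuous_intros g)
  show "integrable \<Gamma> (\<lambda>s. norm (a \<bullet> s) * norm (g s))"
    by (intro integrable_continuous_sphere continuous_intros g)
  have lin: "(\<theta> + t *\<^sub>R a) \<bullet> s = \<theta> \<bullet> s + t * (a \<bullet> s)" for t s
    by (simp add: inner_add_left)
  show "((\<lambda>t. cos ((\<theta> + t *\<^sub>R a) \<bullet> s + p) *\<^sub>R g s) has_vector_derivative
      cos (\<theta> \<bullet> s + (p + pi/2)) *\<^sub>R (a \<bullet> s) *\<^sub>R g s) (at 0)" for s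
  proof -
    have "((\<lambda>t. cos ((\<theta> + t *\<^sub>R a) \<bullet> s + p)) has_real_derivative
        cos (\<theta> \<bullet> s + (p + pi/2)) * (a \<bullet> s)) (at 0)"
      unfolding lin by (auto intro!: derivative_eq_intros simp: cos_add sin_add algebra_simps)
    from has_vector_derivative_scaleR[OF this has_vector_derivative_const[of "g s"]]
    show ?thesis by simp
  qed
  show "norm (cos ((\<theta> + t *\<^sub>R a) \<bullet> s + p) *\<^sub>R g s - cos ((\<theta> + 0 *\<^sub>R a) \<bullet> s + p) *\<^sub>R g s)
      \<le> norm (a \<bullet> s) * norm (g s) * \<bar>t\<bar>" for t s
  proof -
    have "norm (cos x - cos y) \<le> 1 * norm (x - y)" for x y :: real
      by (rule field_differentiable_bound[of UNIV cos "\<lambda>x. - sin x"])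
        (auto intro!: derivative_eq_intros)
    from this[of "(\<theta> + t *\<^sub>R a) \<bullet> s + p" "\<theta> \<bullet> s + p"]
    have "\<bar>cos ((\<theta> + t *\<^sub>R a) \<bullet> s + p) - cos (\<theta> \<bullet> s + p)\<bar> \<le> \<bar>t\<bar> * \<bar>a \<bullet> s\<bar>"
      by (simp add: lin abs_mult)
    then have "\<bar>cos ((\<theta> + t *\<^sub>R a) \<bullet> s + p) - cos (\<theta> \<bullet> s + p)\<bar> * norm (g s) \<le> (\<bar>t\<bar> * \<bar>a \<bullet> s\<bar>) * norm (g s)"
      by (rule mult_right_mono) simp
    then show ?thesis by (simp add: ac_simps flip: scaleR_diff_left)
  qed
qed

lemma cos_integral_zero_deriv:
  fixes g :: "'b \<Rightarrow> 'c::{banach,second_countable_topology}"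
  assumes g: "continuous_on (sphere 0 1) g"
    and zero: "\<And>\<theta>. (LINT s|\<Gamma>. cos (\<theta> \<bullet> s + p) *\<^sub>R g s) = 0"
  shows "(LINT s|\<Gamma>. cos (\<theta> \<bullet> s + (p + pi/2)) *\<^sub>R (a \<bullet> s) *\<^sub>R g s) = 0"
  using cos_integral_has_vector_derivative[OF g, of \<theta> a p]
  by (simp add: zero has_vector_derivative_const vector_derivative_unique_at)

lemma powr_integral_has_derivative:
  fixes z w :: "'b \<Rightarrow> 'c::real_inner"
  assumes \<alpha>: "1 < \<alpha>"
    and z: "continuous_on (sphere 0 1) z" and w: "continuous_on (sphere 0 1) w"
  shows "((\<lambda>t. LINT s|\<Gamma>. norm (w s + t *\<^sub>R z s) powr \<alpha>) has_vector_derivative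
      (LINT s|\<Gamma>. \<alpha> * (norm (w s) powr (\<alpha> - 2) * (w s \<bullet> z s)))) (at 0)" (is ?D)
    and "integrable \<Gamma> (\<lambda>s. \<alpha> * (norm (w s) powr (\<alpha> - 2) * (w s \<bullet> z s)))" (is ?I)
proof -
  obtain B where B: "0 < B" "\<And>s. s \<in> space \<Gamma> \<Longrightarrow> norm (w s) \<le> B"
    using bounded_continuous_sphere[OF w] by blast
  obtain C where C: "0 < C" "\<And>s. s \<in> space \<Gamma> \<Longrightarrow> norm (z s) \<le> C"
    using bounded_continuous_sphere[OF z] by blast
  have int: "integrable \<Gamma> (\<lambda>s. norm (w s + t *\<^sub>R z s) powr \<alpha>)" for t
    using \<alpha> by (intro integrable_continuous_sphere continuous_on_powr' continuous_intros w z) auto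
  \<comment> \<open>Measurability is shown factor by factor: for \<alpha> < 2 the factor
    |w|^(\<alpha>-2) need not be continuous at zeros of \<open>w\<close>.\<close>
  have meas: "(\<lambda>s. \<alpha> * (norm (w s) powr (\<alpha> - 2) * (w s \<bullet> z s))) \<in> borel_measurable \<Gamma>"
    by (intro borel_measurable_times powr_real_measurable borel_measurable_const
        measurable_continuous_sphere continuous_intros w z)
  have deriv: "((\<lambda>t. norm (w s + t *\<^sub>R z s) powr \<alpha>) has_vector_derivative
      \<alpha> * (norm (w s) powr (\<alpha> - 2) * (w s \<bullet> z s))) (at 0)" for s
    using norm_powr_line_has_derivative[OF \<alpha>]
    by (simp add: has_real_derivative_iff_has_vector_derivative)
  \<comment> \<open>For |t| \<le> 1 both norms lie in [0, B + C], where the power function has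
    Lipschitz constant \<alpha> (B + C)^(\<alpha>-1); the last factor C bounds the change of the
    norm per unit of t.\<close>
  have lip: "norm (norm (w s + t *\<^sub>R z s) powr \<alpha> - norm (w s + 0 *\<^sub>R z s) powr \<alpha>)
      \<le> (\<alpha> * (B + C) powr (\<alpha> - 1) * C) * \<bar>t\<bar>"
    if s: "s \<in> space \<Gamma>" and t: "\<bar>t\<bar> \<le> 1" for t s
  proof -
    have tz: "norm (t *\<^sub>R z s) \<le> \<bar>t\<bar> * C"
      using C(2)[OF s] by (simp add: mult_left_mono)
    also have "\<dots> \<le> C" using t C(1) by (simp add: mult_left_le_one_le)
    finally have "norm (w s + t *\<^sub>R z s) \<le> B + C"
      using B(2)[OF s] norm_triangle_ineq[of "w s" "t *\<^sub>R z s"] by linarith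
    then have "\<bar>norm (w s + t *\<^sub>R z s) powr \<alpha> - norm (w s) powr \<alpha>\<bar>
        \<le> \<alpha> * (B + C) powr (\<alpha> - 1) * \<bar>norm (w s + t *\<^sub>R z s) - norm (w s)\<bar>"
      using \<alpha> B(2)[OF s] C(1) by (intro powr_diff_le) auto
    also have "\<dots> \<le> \<alpha> * (B + C) powr (\<alpha> - 1) * (\<bar>t\<bar> * C)"
    proof (intro mult_left_mono)
      show "\<bar>norm (w s + t *\<^sub>R z s) - norm (w s)\<bar> \<le> \<bar>t\<bar> * C"
        using tz norm_triangle_ineq3[of "w s + t *\<^sub>R z s" "w s"] by simp
    qed (use \<alpha> in auto)
    finally show ?thesis by (simp add: ac_simps)
  qed
  show ?D ?I
    using has_vector_derivative_integral[OF int meas deriv integrable_const lip] by auto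
qed

end

text \<open>Up to the factor \<alpha>, the two moments are the derivatives at t = 0 of the two sides
  of \<open>eq\<close>. The measures may live on spheres of different dimensions.\<close>

lemma powr_moment_eq:
  fixes z\<^sub>1 w\<^sub>1 :: "'b::euclidean_space \<Rightarrow> 'd::real_inner"
    and z\<^sub>2 w\<^sub>2 :: "'c::euclidean_space \<Rightarrow> 'd"
  assumes "sphere_measure \<Gamma>\<^sub>1" "sphere_measure \<Gamma>\<^sub>2" and \<alpha>: "1 < \<alpha>"
    and "continuous_on (sphere 0 1) z\<^sub>1" "continuous_on (sphere 0 1) w\<^sub>1"
    and "continuous_on (sphere 0 1) z\<^sub>2" "continuous_on (sphere 0 1) w\<^sub>2"
    and eq: "\<And>t. (LINT s|\<Gamma>\<^sub>1. norm (w\<^sub>1 s + t *\<^sub>R z\<^sub>1 s) powr \<alpha>) = (LINT s|\<Gamma>\<^sub>2. norm (w\<^sub>2 s + t *\<^sub>R z\<^sub>2 s) powr \<alpha>)"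
  shows "(LINT s|\<Gamma>\<^sub>1. norm (w\<^sub>1 s) powr (\<alpha> - 2) * (w\<^sub>1 s \<bullet> z\<^sub>1 s)) =
    (LINT s|\<Gamma>\<^sub>2. norm (w\<^sub>2 s) powr (\<alpha> - 2) * (w\<^sub>2 s \<bullet> z\<^sub>2 s))"
proof -
  interpret S1: sphere_measure \<Gamma>\<^sub>1 by fact
  interpret S2: sphere_measure \<Gamma>\<^sub>2 by fact
  have "(LINT s|\<Gamma>\<^sub>1. \<alpha> * (norm (w\<^sub>1 s) powr (\<alpha> - 2) * (w\<^sub>1 s \<bullet> z\<^sub>1 s))) =
    (LINT s|\<Gamma>\<^sub>2. \<alpha> * (norm (w\<^sub>2 s) powr (\<alpha> - 2) * (w\<^sub>2 s \<bullet> z\<^sub>2 s)))"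
    using S1.powr_integral_has_derivative(1)[of \<alpha> z\<^sub>1 w\<^sub>1] S2.powr_integral_has_derivative(1)[of \<alpha> z\<^sub>2 w\<^sub>2]
      assms(3-7) unfolding eq by (blast intro: vector_derivative_unique_at)
  then show ?thesis using \<alpha> by simp
qed

section \<open>Signed power moments\<close>

text \<open>By periodicity, the part of [v, 2 pi + v] beyond 2 pi can be moved back to
  [0, v].\<close>

lemma integral_cos_powr_shift:
  assumes \<alpha>: "0 < \<alpha>" and v: "0 \<le> v" "v \<le> 2*pi"
  shows "integral {0..2*pi} (\<lambda>u. \<bar>cos (u + v)\<bar> powr \<alpha>) = integral {0..2*pi} (\<lambda>u. \<bar>cos u\<bar> powr \<alpha>)"
proof -
  let ?g = "\<lambda>u. \<bar>cos u\<bar> powr \<alpha>"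
  have cont: "continuous_on S ?g" for S
    using \<alpha> by (intro continuous_on_powr' continuous_intros) auto
  have int: "?g integrable_on {a..b}" for a b
    by (rule integrable_continuous_real[OF cont])
  have shift: "integral {a..b} (\<lambda>x. ?g (x + c)) = integral {a+c..b+c} ?g" for a b c
    using integral_shift[OF cont, of a b c] by (simp add: comp_def)
  have "integral {0..2*pi} (\<lambda>u. ?g (u + v)) = integral {v..2*pi + v} ?g"
    using shift[of 0 "2*pi" v] by simp
  also have "\<dots> = integral {v..2*pi} ?g + integral {2*pi..2*pi + v} ?g"
    using Henstock_Kurzweil_Integration.integral_combine[OF _ _ int, of v "2*pi" "2*pi + v"] v by simp
  also have "integral {2*pi..2*pi + v} ?g = integral {0..v} ?g"
    using shift[of 0 v "2*pi"] by (simp add: add.commute)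
  also have "integral {v..2*pi} ?g + integral {0..v} ?g = integral {0..2*pi} ?g"
    using v Henstock_Kurzweil_Integration.integral_combine[OF _ _ int, of 0 v "2*pi"] by simp
  finally show ?thesis .
qed

text \<open>This is the constant relating moduli to rotation averages; positivity allows cancelling
  it.\<close>

lemma integral_cos_powr_pos:
  assumes \<alpha>: "0 < \<alpha>"
  shows "0 < integral {0..2*pi} (\<lambda>u. \<bar>cos u\<bar> powr \<alpha>)"
proof -
  have cont: "continuous_on {0..2*pi} (\<lambda>u. \<bar>cos u\<bar> powr \<alpha>)"
    using \<alpha> by (intro continuous_on_powr' continuous_intros) auto
  have "integral {0..2*pi} (\<lambda>u. \<bar>cos u\<bar> powr \<alpha>) \<noteq> 0"
    using integral_eq_0_iff[OF cont] by (auto intro!: bexI[of _ 0])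
  moreover have "0 \<le> integral {0..2*pi} (\<lambda>u. \<bar>cos u\<bar> powr \<alpha>)"
    by (intro integral_nonneg integrable_continuous_real cont) auto
  ultimately show ?thesis by simp
qed

abbreviation circle_angles :: "real measure" where
  "circle_angles \<equiv> restrict_space lborel {0..2*pi}"

lemma finite_measure_circle_angles: "finite_measure circle_angles"
  by (rule finite_measureI) (simp add: space_restrict_space emeasure_restrict_space)

text \<open>In polar form y = |y| e^(iv), so Re (e^(iu) y) = |y| cos (u + v), and the average over u
  does not depend on v.\<close>

lemma circle_average_powr:
  assumes \<alpha>: "0 < \<alpha>"
  shows "(LINT u|circle_angles. \<bar>Re (cis u * y)\<bar> powr \<alpha>) =
    integral {0..2*pi} (\<lambda>u. \<bar>cos u\<bar> powr \<alpha>) * cmod y powr \<alpha>"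
proof -
  define v where "v = Arg2pi y"
  have v: "0 \<le> v" "v \<le> 2*pi" "y = of_real (cmod y) * exp (\<i> * of_real v)"
    using Arg2pi[of y] by (auto simp: v_def is_Arg_def)
  have Re: "Re (cis u * y) = cmod y * cos (u + v)" for u
    by (subst v(3)) (simp add: cis_conv_exp[symmetric] cos_add algebra_simps)
  have cont: "continuous_on {0..2*pi} (\<lambda>u. \<bar>Re (cis u * y)\<bar> powr \<alpha>)"
    unfolding Re using \<alpha> by (intro continuous_on_powr' continuous_intros) auto
  have "(LINT u|circle_angles. \<bar>Re (cis u * y)\<bar> powr \<alpha>) = (LINT u:{0..2*pi}|lborel. \<bar>Re (cis u * y)\<bar> powr \<alpha>)"
    by (simp add: integral_restrict_space set_lebesgue_integral_def)
  also have "\<dots> = integral {0..2*pi} (\<lambda>u. \<bar>Re (cis u * y)\<bar> powr \<alpha>)"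
    by (intro set_borel_integral_eq_integral(2) borel_integrable_atLeastAtMost' cont)
  also have "\<dots> = integral {0..2*pi} (\<lambda>u. \<bar>cos (u + v)\<bar> powr \<alpha> * cmod y powr \<alpha>)"
    unfolding Re abs_mult powr_mult by (simp add: mult.commute)
  also have "\<dots> = integral {0..2*pi} (\<lambda>u. \<bar>cos u\<bar> powr \<alpha>) * cmod y powr \<alpha>"
    by (simp add: integral_cos_powr_shift[OF \<alpha> v(1,2)])
  finally show ?thesis .
qed

text \<open>Fubini for the pointwise circle average: the integrand is bounded and the product
  measure finite.\<close>

lemma (in sphere_measure) cmod_powr_integral_eq_average:
  assumes \<alpha>: "0 < \<alpha>" and y: "continuous_on (sphere 0 1) y"
  shows "integral {0..2*pi} (\<lambda>u. \<bar>cos u\<bar> powr \<alpha>) * (LINT s|\<Gamma>. cmod (y s) powr \<alpha>) =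
    (LINT u|circle_angles. (LINT s|\<Gamma>. \<bar>Re (cis u * y s)\<bar> powr \<alpha>))"
proof -
  interpret C: finite_measure circle_angles by (rule finite_measure_circle_angles)
  interpret P: pair_sigma_finite circle_angles \<Gamma> ..
  interpret PF: finite_measure "circle_angles \<Otimes>\<^sub>M \<Gamma>"
    by (rule finite_measure_pair_measure) unfold_locales
  obtain B where B: "0 < B" "\<And>s. s \<in> space \<Gamma> \<Longrightarrow> norm (y s) \<le> B"
    using bounded_continuous_sphere[OF y] by blast
  have [measurable]: "y \<in> borel_measurable \<Gamma>"
    by (rule measurable_continuous_sphere[OF y])
  have "cis \<in> borel_measurable borel"
    by (intro borel_measurable_continuous_onI continuous_intros)
  then have [measurable]: "cis \<in> borel_measurable circle_angles"
    by (simp add: measurable_restrict_space1)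
  have "integrable (circle_angles \<Otimes>\<^sub>M \<Gamma>) (\<lambda>(u, s). \<bar>Re (cis u * y s)\<bar> powr \<alpha>)"
  proof (rule PF.integrable_const_bound[where B="B powr \<alpha>"])
    have "\<bar>Re (cis u * y s)\<bar> powr \<alpha> \<le> B powr \<alpha>" if "s \<in> space \<Gamma>" for u s
    proof (rule powr_mono2)
      have "\<bar>Re (cis u * y s)\<bar> \<le> cmod (cis u * y s)" by (rule abs_Re_le_cmod)
      also have "\<dots> \<le> B" using B(2)[OF that] by (simp add: norm_mult)
      finally show "\<bar>Re (cis u * y s)\<bar> \<le> B" .
    qed (use \<alpha> in auto)
    then show "AE x in circle_angles \<Otimes>\<^sub>M \<Gamma>. norm (case x of (u, s) \<Rightarrow> \<bar>Re (cis u * y s)\<bar> powr \<alpha>) \<le> B powr \<alpha>"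
      by (auto simp: space_pair_measure)
  qed measurable
  from P.Fubini_integral[OF this] show ?thesis
    by (simp add: circle_average_powr[OF \<alpha>] del: times_complex.sel)
qed

section \<open>Covariation integrands as derivatives of \<alpha>-th powers\<close>

text \<open>The real part of z times the conjugate of w is w \<bullet> z, and its imaginary part is
  w \<bullet> (-i z). The complex integrand thus splits into two real ones of the form covered by
  \<open>powr_moment_eq\<close>.\<close>

lemma mult_signed_power_complex:
  "z * signed_power_complex w (\<alpha> - 1) =
    of_real (cmod w powr (\<alpha> - 2) * (w \<bullet> z)) + \<i> * of_real (cmod w powr (\<alpha> - 2) * (w \<bullet> (- \<i> * z)))"
  by (simp add: complex_eq_iff signed_power_complex_def inner_complex_def algebra_simps)

lemma (in sphere_measure) integrable_inner_powr:
  fixes z w :: "'b \<Rightarrow> 'c::real_inner"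
  assumes "1 < \<alpha>" "continuous_on (sphere 0 1) z" "continuous_on (sphere 0 1) w"
  shows "integrable \<Gamma> (\<lambda>s. norm (w s) powr (\<alpha> - 2) * (w s \<bullet> z s))"
  using powr_integral_has_derivative(2)[OF assms] assms(1) by simp

lemma (in sphere_measure)
  fixes z w :: "'b \<Rightarrow> complex"
  assumes \<alpha>: "1 < \<alpha>" and [continuous_intros]: "continuous_on (sphere 0 1) z" "continuous_on (sphere 0 1) w"
  shows integrable_signed_power_complex: "integrable \<Gamma> (\<lambda>s. z s * signed_power_complex (w s) (\<alpha> - 1))"
    and integral_signed_power_complex: "(CLINT s|\<Gamma>. z s * signed_power_complex (w s) (\<alpha> - 1)) =
      of_real (LINT s|\<Gamma>. cmod (w s) powr (\<alpha> - 2) * (w s \<bullet> z s)) +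
      \<i> * of_real (LINT s|\<Gamma>. cmod (w s) powr (\<alpha> - 2) * (w s \<bullet> (- \<i> * z s)))"
proof -
  have int: "integrable \<Gamma> (\<lambda>s. complex_of_real (cmod (w s) powr (\<alpha> - 2) * (w s \<bullet> (c * z s))))" for c
    by (intro integrable_of_real integrable_inner_powr \<alpha> continuous_intros)
  show "integrable \<Gamma> (\<lambda>s. z s * signed_power_complex (w s) (\<alpha> - 1))"
    unfolding mult_signed_power_complex using int[of 1] int[of "- \<i>"]
    by (intro Bochner_Integration.integrable_add integrable_mult_right) simp_all
  show "(CLINT s|\<Gamma>. z s * signed_power_complex (w s) (\<alpha> - 1)) =
      of_real (LINT s|\<Gamma>. cmod (w s) powr (\<alpha> - 2) * (w s \<bullet> z s)) +
      \<i> * of_real (LINT s|\<Gamma>. cmod (w s) powr (\<alpha> - 2) * (w s \<bullet> (- \<i> * z s)))"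
    unfolding mult_signed_power_complex using int[of 1] int[of "- \<i>"]
    by (subst Bochner_Integration.integral_add) (auto simp flip: of_real_mult)
qed

lemma complex_moment_eq:
  fixes z\<^sub>1 w\<^sub>1 :: "'b::euclidean_space \<Rightarrow> complex" and z\<^sub>2 w\<^sub>2 :: "'c::euclidean_space \<Rightarrow> complex"
  assumes "sphere_measure \<Gamma>\<^sub>1" "sphere_measure \<Gamma>\<^sub>2" and \<alpha>: "1 < \<alpha>"
    and cont [continuous_intros]: "continuous_on (sphere 0 1) z\<^sub>1" "continuous_on (sphere 0 1) w\<^sub>1"
      "continuous_on (sphere 0 1) z\<^sub>2" "continuous_on (sphere 0 1) w\<^sub>2"
    and eq: "\<And>a b. (LINT s|\<Gamma>\<^sub>1. \<bar>a \<bullet> z\<^sub>1 s + b \<bullet> w\<^sub>1 s\<bar> powr \<alpha>) = (LINT s|\<Gamma>\<^sub>2. \<bar>a \<bullet> z\<^sub>2 s + b \<bullet> w\<^sub>2 s\<bar> powr \<alpha>)"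
  shows "(CLINT s|\<Gamma>\<^sub>1. z\<^sub>1 s * signed_power_complex (w\<^sub>1 s) (\<alpha> - 1)) =
    (CLINT s|\<Gamma>\<^sub>2. z\<^sub>2 s * signed_power_complex (w\<^sub>2 s) (\<alpha> - 1))"
proof -
  interpret S1: sphere_measure \<Gamma>\<^sub>1 by fact
  interpret S2: sphere_measure \<Gamma>\<^sub>2 by fact
  \<comment> \<open>Every rotated real part is a real linear form in z and w, so \<open>eq\<close>
    applies for each angle under the circle integral.\<close>
  have Re: "Re (cis u * (w + c * z)) = cnj (cis u * c) \<bullet> z + cnj (cis u) \<bullet> w" for u c z w
    by (simp add: inner_complex_def algebra_simps)
  have mod: "(LINT s|\<Gamma>\<^sub>1. cmod (w\<^sub>1 s + c * z\<^sub>1 s) powr \<alpha>) = (LINT s|\<Gamma>\<^sub>2. cmod (w\<^sub>2 s + c * z\<^sub>2 s) powr \<alpha>)" for c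
  proof -
    have "integral {0..2*pi} (\<lambda>u. \<bar>cos u\<bar> powr \<alpha>) * (LINT s|\<Gamma>\<^sub>1. cmod (w\<^sub>1 s + c * z\<^sub>1 s) powr \<alpha>) =
        integral {0..2*pi} (\<lambda>u. \<bar>cos u\<bar> powr \<alpha>) * (LINT s|\<Gamma>\<^sub>2. cmod (w\<^sub>2 s + c * z\<^sub>2 s) powr \<alpha>)"
    proof -
      have "continuous_on (sphere 0 1) (\<lambda>s. w\<^sub>1 s + c * z\<^sub>1 s)" "continuous_on (sphere 0 1) (\<lambda>s. w\<^sub>2 s + c * z\<^sub>2 s)"
        by (intro continuous_intros)+
      then show ?thesis
        using \<alpha> by (simp only: S1.cmod_powr_integral_eq_average S2.cmod_powr_integral_eq_average Re eq)
    qed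
    moreover have "integral {0..2*pi} (\<lambda>u. \<bar>cos u\<bar> powr \<alpha>) \<noteq> 0"
      using integral_cos_powr_pos[of \<alpha>] \<alpha> by simp
    ultimately show ?thesis by simp
  qed
  have inner: "(LINT s|\<Gamma>\<^sub>1. cmod (w\<^sub>1 s) powr (\<alpha> - 2) * (w\<^sub>1 s \<bullet> (c * z\<^sub>1 s))) =
      (LINT s|\<Gamma>\<^sub>2. cmod (w\<^sub>2 s) powr (\<alpha> - 2) * (w\<^sub>2 s \<bullet> (c * z\<^sub>2 s)))" for c
  proof (rule powr_moment_eq[OF assms(1-3)])
    show "(LINT s|\<Gamma>\<^sub>1. cmod (w\<^sub>1 s + t *\<^sub>R (c * z\<^sub>1 s)) powr \<alpha>) = (LINT s|\<Gamma>\<^sub>2. cmod (w\<^sub>2 s + t *\<^sub>R (c * z\<^sub>2 s)) powr \<alpha>)" for t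
      using mod[of "t *\<^sub>R c"] by simp
  qed (intro continuous_intros)+
  \<comment> \<open>The factors c = 1 and c = -i give the real and the imaginary part.\<close>
  show ?thesis
    using S1.integral_signed_power_complex[OF \<alpha> cont(1,2)] S2.integral_signed_power_complex[OF \<alpha> cont(3,4)]
      inner[of 1] inner[of "- \<i>"] by simp
qed

text \<open>Since sgn w |w|^(\<alpha>-1) = |w|^(\<alpha>-2) w, the real integrand already has the
  derivative form and no rotation is involved.\<close>

lemma mult_signed_power_real:
  "z * signed_power_real w (\<alpha> - 1) = norm w powr (\<alpha> - 2) * (w \<bullet> z)"
proof (cases "w = 0")
  case False
  then have "\<bar>w\<bar> powr (\<alpha> - 1) = \<bar>w\<bar> powr (\<alpha> - 2) * \<bar>w\<bar>"
    using powr_add[of "\<bar>w\<bar>" "\<alpha> - 2" 1] by simp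
  then show ?thesis
    by (simp add: signed_power_real_def sgn_mult_abs[symmetric] mult_sgn_abs)
qed (simp add: signed_power_real_def)

lemma real_moment_eq:
  fixes z\<^sub>1 w\<^sub>1 :: "'b::euclidean_space \<Rightarrow> real" and z\<^sub>2 w\<^sub>2 :: "'c::euclidean_space \<Rightarrow> real"
  assumes "sphere_measure \<Gamma>\<^sub>1" "sphere_measure \<Gamma>\<^sub>2" "1 < \<alpha>"
    and "continuous_on (sphere 0 1) z\<^sub>1" "continuous_on (sphere 0 1) w\<^sub>1"
      "continuous_on (sphere 0 1) z\<^sub>2" "continuous_on (sphere 0 1) w\<^sub>2"
    and eq: "\<And>a b. (LINT s|\<Gamma>\<^sub>1. \<bar>a \<bullet> z\<^sub>1 s + b \<bullet> w\<^sub>1 s\<bar> powr \<alpha>) = (LINT s|\<Gamma>\<^sub>2. \<bar>a \<bullet> z\<^sub>2 s + b \<bullet> w\<^sub>2 s\<bar> powr \<alpha>)"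
  shows "(LINT s|\<Gamma>\<^sub>1. z\<^sub>1 s * signed_power_real (w\<^sub>1 s) (\<alpha> - 1)) =
    (LINT s|\<Gamma>\<^sub>2. z\<^sub>2 s * signed_power_real (w\<^sub>2 s) (\<alpha> - 1))"
  unfolding mult_signed_power_real
proof (rule powr_moment_eq[OF assms(1-7)])
  show "(LINT s|\<Gamma>\<^sub>1. norm (w\<^sub>1 s + t *\<^sub>R z\<^sub>1 s) powr \<alpha>) = (LINT s|\<Gamma>\<^sub>2. norm (w\<^sub>2 s + t *\<^sub>R z\<^sub>2 s) powr \<alpha>)" for t
    using eq[of t 1] by (simp add: add.commute)
qed

section \<open>Spectral measures of linear images\<close>

lemma is_spectral_measure_sphere_measure:
  "is_spectral_measure \<alpha> M X \<Gamma> \<Longrightarrow> sphere_measure \<Gamma>"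
  by (simp add: is_spectral_measure_def sphere_measure_def sphere_measure_axioms_def)

text \<open>Push the measure with density $|As|^\alpha$ forward along $s \mapsto As/|As|$, using that $t \mapsto |t|^\alpha$ is homogeneous. The value
  \<open>e\<close> where $As = 0$ is arbitrary, as the density vanishes there.\<close>

lemma is_spectral_measure_linear_image:
  fixes A :: "'b::euclidean_space \<Rightarrow> 'c::euclidean_space"
  assumes \<Gamma>: "is_spectral_measure \<alpha> M X \<Gamma>" and A: "linear A" and \<alpha>: "0 < \<alpha>"
  shows "\<exists>\<Gamma>'. is_spectral_measure \<alpha> M (\<lambda>\<omega>. A (X \<omega>)) \<Gamma>'"
proof -
  interpret sphere_measure \<Gamma> by (rule is_spectral_measure_sphere_measure[OF \<Gamma>])
  have cA: "continuous_on S A" for S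
    using A by (simp add: linear_continuous_on linear_conv_bounded_linear)
  have [measurable]: "A \<in> borel_measurable \<Gamma>"
    by (rule measurable_continuous_sphere[OF cA])
  obtain e :: 'c where e: "norm e = 1"
    using vector_choose_size[of 1] by auto
  define T where "T s = (if A s = 0 then e else A s /\<^sub>R norm (A s))" for s
  define S where "S = restrict_space borel (sphere (0::'c) 1)"
  have [measurable]: "T \<in> measurable \<Gamma> S"
    unfolding S_def
  proof (rule measurable_restrict_space2)
    show "T \<in> borel_measurable \<Gamma>" unfolding T_def by measurable
  qed (auto simp: T_def e)
  define D where "D = density \<Gamma> (\<lambda>s. ennreal (norm (A s) powr \<alpha>))"
  have D_sets [measurable_cong]: "sets D = sets \<Gamma>" by (simp add: D_def)
  define \<Gamma>' where "\<Gamma>' = distr D S T"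
  have int: "integrable \<Gamma> (\<lambda>s. norm (A s) powr \<alpha>)"
    using \<alpha> by (intro integrable_continuous_sphere continuous_on_powr' continuous_intros cA) auto
  have "finite_measure D"
  proof
    show "emeasure D (space D) \<noteq> \<infinity>"
      using int by (auto simp: D_def emeasure_density integrable_iff_bounded cong: nn_integral_cong)
  qed
  then have fin: "finite_measure \<Gamma>'"
    unfolding \<Gamma>'_def by (rule finite_measure.finite_measure_distr) measurable
  have neg: "uminus \<in> measurable \<Gamma> \<Gamma>"
    unfolding measurable_cong_sets[OF sets_sphere sets_sphere]
    by (rule measurable_restrict_space2) (auto simp: space_restrict_space measurable_restrict_space1)
  \<comment> \<open>The symmetry of \<Gamma>, stated with images of sets, is recast as invariance
    under a pushforward so that s can be replaced by -s in integrals.\<close>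
  have distr_neg: "distr \<Gamma> \<Gamma> uminus = \<Gamma>"
  proof (rule measure_eqI)
    fix B assume "B \<in> sets (distr \<Gamma> \<Gamma> uminus)"
    then have B: "B \<in> sets \<Gamma>" by simp
    then have "B \<subseteq> space \<Gamma>" by (rule sets.sets_into_space)
    then have "uminus -` B \<inter> space \<Gamma> = uminus ` B"
      by (force simp: space_sphere image_iff)
    then show "emeasure (distr \<Gamma> \<Gamma> uminus) B = emeasure \<Gamma> B"
      using \<Gamma> B by (simp add: emeasure_distr[OF neg] is_spectral_measure_def)
  qed simp
  have em: "emeasure \<Gamma>' B = (\<integral>\<^sup>+s. ennreal (norm (A s) powr \<alpha>) * indicator B (T s) \<partial>\<Gamma>)" if B [measurable]: "B \<in> sets S" for B
  proof -
    have "emeasure \<Gamma>' B = (\<integral>\<^sup>+s. ennreal (norm (A s) powr \<alpha>) * indicator (T -` B \<inter> space \<Gamma>) s \<partial>\<Gamma>)"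
      unfolding \<Gamma>'_def by (simp add: emeasure_distr D_def emeasure_density)
    also have "\<dots> = (\<integral>\<^sup>+s. ennreal (norm (A s) powr \<alpha>) * indicator B (T s) \<partial>\<Gamma>)"
      by (rule nn_integral_cong) (auto split: split_indicator)
    finally show ?thesis .
  qed
  have sym: "emeasure \<Gamma>' (uminus ` B) = emeasure \<Gamma>' B" if B: "B \<in> sets S" for B
  proof -
    have "uminus \<in> measurable S S"
      unfolding S_def by (rule measurable_restrict_space2) (auto simp: space_restrict_space measurable_restrict_space1)
    moreover have "uminus -` B \<inter> space S = uminus ` B"
      using sets.sets_into_space[OF B] by (force simp: S_def space_restrict_space image_iff)
    ultimately have B': "uminus ` B \<in> sets S"
      using measurable_sets[of uminus S S B] B by simp
    note [measurable] = B B'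
    have "emeasure \<Gamma>' B = (\<integral>\<^sup>+s. ennreal (norm (A s) powr \<alpha>) * indicator B (T s) \<partial>distr \<Gamma> \<Gamma> uminus)"
      by (simp add: em[OF B] distr_neg)
    also have "\<dots> = (\<integral>\<^sup>+s. ennreal (norm (A (- s)) powr \<alpha>) * indicator B (T (- s)) \<partial>\<Gamma>)"
      by (rule nn_integral_distr[OF neg]) (simp add: distr_neg)
    also have "\<dots> = (\<integral>\<^sup>+s. ennreal (norm (A s) powr \<alpha>) * indicator (uminus ` B) (T s) \<partial>\<Gamma>)"
    proof (rule nn_integral_cong)
      fix s
      \<comment> \<open>\<open>T\<close> is odd only off the kernel of \<open>A\<close>; on the
        kernel it is the constant \<open>e\<close>, but the density vanishes there.\<close>
      have "T (- s) = - T s" if "A s \<noteq> 0"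
        using that by (simp add: T_def linear_neg[OF A])
      moreover have "indicator B (- x) = (indicator (uminus ` B) x :: ennreal)" for x
        by (auto split: split_indicator simp: image_iff) (metis minus_minus)
      ultimately show "ennreal (norm (A (- s)) powr \<alpha>) * indicator B (T (- s)) =
          ennreal (norm (A s) powr \<alpha>) * indicator (uminus ` B) (T s)"
        by (cases "A s = 0") (simp_all add: linear_neg[OF A])
    qed
    also have "\<dots> = emeasure \<Gamma>' (uminus ` B)"
      by (simp add: em[OF B'])
    finally show ?thesis by simp
  qed
  have char: "(LINT s|\<Gamma>'. \<bar>t \<bullet> s\<bar> powr \<alpha>) = (LINT s|\<Gamma>. \<bar>adjoint A t \<bullet> s\<bar> powr \<alpha>)" for t
  proof -
    have [measurable]: "(\<lambda>s. \<bar>t \<bullet> s\<bar> powr \<alpha>) \<in> borel_measurable S"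
      unfolding S_def by (rule measurable_restrict_space1) measurable
    have "(LINT s|\<Gamma>'. \<bar>t \<bullet> s\<bar> powr \<alpha>) = (LINT s|D. \<bar>t \<bullet> T s\<bar> powr \<alpha>)"
      unfolding \<Gamma>'_def by (rule integral_distr) measurable
    also have "\<dots> = (LINT s|\<Gamma>. norm (A s) powr \<alpha> *\<^sub>R \<bar>t \<bullet> T s\<bar> powr \<alpha>)"
      unfolding D_def by (rule integral_density) auto
    also have "\<dots> = (LINT s|\<Gamma>. \<bar>adjoint A t \<bullet> s\<bar> powr \<alpha>)"
    \<comment> \<open>The density cancels the normalisation in \<open>T\<close>: |As|^\<alpha> |t
      \<bullet> As/|As||^\<alpha> = |t \<bullet> As|^\<alpha>, with both sides 0 when As =
      0.\<close>
    proof (rule Bochner_Integration.integral_cong)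
      fix s
      have "adjoint A t \<bullet> s = t \<bullet> A s"
        using adjoint_works[OF A, of s t] by (simp add: inner_commute)
      then show "norm (A s) powr \<alpha> *\<^sub>R \<bar>t \<bullet> T s\<bar> powr \<alpha> = \<bar>adjoint A t \<bullet> s\<bar> powr \<alpha>"
        using \<alpha> by (cases "A s = 0") (simp_all add: T_def abs_mult mult.assoc[symmetric] flip: powr_mult)
    qed simp
    finally show ?thesis .
  qed
  have "is_spectral_measure \<alpha> M (\<lambda>\<omega>. A (X \<omega>)) \<Gamma>'"
    unfolding is_spectral_measure_def
  proof (intro conjI allI ballI)
    show "sets \<Gamma>' = sets (restrict_space borel (sphere 0 1))"
      by (simp add: \<Gamma>'_def S_def)
    show "finite_measure \<Gamma>'" by (rule fin)
    show "emeasure \<Gamma>' (uminus ` B) = emeasure \<Gamma>' B" if "B \<in> sets \<Gamma>'" for B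
      using that by (intro sym) (simp add: \<Gamma>'_def)
    fix t
    have "(CLINT \<omega>|M. iexp (t \<bullet> A (X \<omega>))) = (CLINT \<omega>|M. iexp (adjoint A t \<bullet> X \<omega>))"
      using adjoint_works[OF A] by (simp add: inner_commute)
    then show "(CLINT \<omega>|M. iexp (t \<bullet> A (X \<omega>))) = complex_of_real (exp (- (LINT s|\<Gamma>'. \<bar>t \<bullet> s\<bar> powr \<alpha>)))"
      using \<Gamma> by (simp add: is_spectral_measure_def char)
  qed
  then show ?thesis by blast
qed

text \<open>The characteristic function of AX at t is that of X at the adjoint image of t, and the
  real exponential is injective. As \<Gamma>' is arbitrary, this also covers the chosen
  measure.\<close>

lemma spectral_measure_exponent_linear_image:
  fixes A :: "'b::euclidean_space \<Rightarrow> 'c::euclidean_space"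
  assumes \<Gamma>: "is_spectral_measure \<alpha> M X \<Gamma>" and A: "linear A"
    and \<Gamma>': "is_spectral_measure \<alpha> M (\<lambda>\<omega>. A (X \<omega>)) \<Gamma>'"
  shows "(LINT s|\<Gamma>'. \<bar>t \<bullet> s\<bar> powr \<alpha>) = (LINT s|\<Gamma>. \<bar>t \<bullet> A s\<bar> powr \<alpha>)"
proof -
  have adj: "adjoint A t \<bullet> x = t \<bullet> A x" for x
    using adjoint_works[OF A, of x t] by (simp add: inner_commute)
  have "complex_of_real (exp (- (LINT s|\<Gamma>'. \<bar>t \<bullet> s\<bar> powr \<alpha>))) = (CLINT \<omega>|M. iexp (t \<bullet> A (X \<omega>)))"
    using \<Gamma>' by (simp add: is_spectral_measure_def)
  also have "\<dots> = (CLINT \<omega>|M. iexp (adjoint A t \<bullet> X \<omega>))"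
    by (simp add: adj)
  also have "\<dots> = complex_of_real (exp (- (LINT s|\<Gamma>. \<bar>adjoint A t \<bullet> s\<bar> powr \<alpha>)))"
    using \<Gamma> by (simp add: is_spectral_measure_def)
  finally show ?thesis by (simp add: adj)
qed

lemma is_spectral_measure_spectral_measure:
  "is_spectral_measure \<alpha> M X \<Gamma> \<Longrightarrow> is_spectral_measure \<alpha> M X (spectral_measure \<alpha> M X)"
  unfolding spectral_measure_def by (rule someI)

text \<open>The moments are compared between the measure of the pair, with the two coordinate
  projections, and \<Gamma>, with \<open>p\<close> and \<open>q\<close>. The exponent at (a, b)
  supplies the required equality.\<close>

lemma covariation_complex_linear:
  fixes X :: "'a \<Rightarrow> 'b::euclidean_space"
  assumes \<Gamma>: "is_spectral_measure \<alpha> M X \<Gamma>" and \<alpha>: "1 < \<alpha>" and p: "linear p" and q: "linear q"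
  shows "covariation_complex \<alpha> M (\<lambda>\<omega>. p (X \<omega>)) (\<lambda>\<omega>. q (X \<omega>)) =
    (CLINT s|\<Gamma>. p s * signed_power_complex (q s) (\<alpha> - 1))"
proof -
  let ?A = "\<lambda>x. (p x, q x)"
  let ?\<Gamma>' = "spectral_measure \<alpha> M (\<lambda>\<omega>. ?A (X \<omega>))"
  have A: "linear ?A"
    using p q by (simp add: linear_iff)
  have \<Gamma>': "is_spectral_measure \<alpha> M (\<lambda>\<omega>. ?A (X \<omega>)) ?\<Gamma>'"
    using is_spectral_measure_linear_image[OF \<Gamma> A] \<alpha> is_spectral_measure_spectral_measure by force
  have cont: "continuous_on S p" "continuous_on S q" for S
    using p q by (simp_all add: linear_continuous_on linear_conv_bounded_linear)
  show ?thesis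
    unfolding covariation_complex_def
  proof (rule complex_moment_eq[OF _ _ \<alpha>])
    show "(LINT s|?\<Gamma>'. \<bar>a \<bullet> fst s + b \<bullet> snd s\<bar> powr \<alpha>) = (LINT s|\<Gamma>. \<bar>a \<bullet> p s + b \<bullet> q s\<bar> powr \<alpha>)" for a b
      using spectral_measure_exponent_linear_image[OF \<Gamma> A \<Gamma>', of "(a, b)"]
      by (simp add: inner_prod_def)
  qed (use is_spectral_measure_sphere_measure \<Gamma> \<Gamma>' cont in \<open>auto intro!: continuous_intros\<close>)
qed

lemma covariation_real_linear:
  fixes X :: "'a \<Rightarrow> 'b::euclidean_space"
  assumes \<Gamma>: "is_spectral_measure \<alpha> M X \<Gamma>" and \<alpha>: "1 < \<alpha>" and p: "linear p" and q: "linear q"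
  shows "covariation_real \<alpha> M (\<lambda>\<omega>. p (X \<omega>)) (\<lambda>\<omega>. q (X \<omega>)) =
    (LINT s|\<Gamma>. p s * signed_power_real (q s) (\<alpha> - 1))"
proof -
  let ?A = "\<lambda>x. (p x, q x)"
  let ?\<Gamma>' = "spectral_measure \<alpha> M (\<lambda>\<omega>. ?A (X \<omega>))"
  have A: "linear ?A"
    using p q by (simp add: linear_iff)
  have \<Gamma>': "is_spectral_measure \<alpha> M (\<lambda>\<omega>. ?A (X \<omega>)) ?\<Gamma>'"
    using is_spectral_measure_linear_image[OF \<Gamma> A] \<alpha> is_spectral_measure_spectral_measure by force
  have cont: "continuous_on S p" "continuous_on S q" for S
    using p q by (simp_all add: linear_continuous_on linear_conv_bounded_linear)
  show ?thesis
    unfolding covariation_real_def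
  proof (rule real_moment_eq[OF _ _ \<alpha>])
    show "(LINT s|?\<Gamma>'. \<bar>a \<bullet> fst s + b \<bullet> snd s\<bar> powr \<alpha>) = (LINT s|\<Gamma>. \<bar>a \<bullet> p s + b \<bullet> q s\<bar> powr \<alpha>)" for a b
      using spectral_measure_exponent_linear_image[OF \<Gamma> A \<Gamma>', of "(a, b)"]
      by (simp add: inner_prod_def)
  qed (use is_spectral_measure_sphere_measure \<Gamma> \<Gamma>' cont in \<open>auto intro!: continuous_intros\<close>)
qed

section \<open>Vanishing third derivatives\<close>

text \<open>The directions 1 and i in coordinate j produce the factors Re s_j and Im s_j, which the
  operator reassembles to s_j, not to its conjugate.\<close>

lemma dbar_cos_integral:
  fixes \<Gamma> :: "(complex^'n) measure"
  assumes "sphere_measure \<Gamma>" and g: "continuous_on (sphere 0 1) g"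
  shows "dbar j (\<lambda>\<theta>. CLINT s|\<Gamma>. cos (\<theta> \<bullet> s + p) *\<^sub>R g s) =
    (\<lambda>\<theta>. CLINT s|\<Gamma>. cos (\<theta> \<bullet> s + (p + pi/2)) *\<^sub>R (s $ j * g s))"
proof
  interpret sphere_measure \<Gamma> by fact
  fix \<theta> :: "complex^'n"
  let ?c = "\<lambda>s. cos (\<theta> \<bullet> s + (p + pi/2))"
  have ax: "axis j (complex_of_real t) = t *\<^sub>R axis j 1" "axis j (\<i> * complex_of_real t) = t *\<^sub>R axis j \<i>" for t
    by (simp_all add: vec_eq_iff axis_def complex_eq_iff)
  have 1: "vector_derivative (\<lambda>t. CLINT s|\<Gamma>. cos ((\<theta> + t *\<^sub>R axis j 1) \<bullet> s + p) *\<^sub>R g s) (at 0) =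
      (CLINT s|\<Gamma>. ?c s *\<^sub>R Re (s $ j) *\<^sub>R g s)"
    using cos_integral_has_vector_derivative[OF g, of \<theta> "axis j 1" p]
    by (intro vector_derivative_at) (simp add: inner_axis')
  have 2: "vector_derivative (\<lambda>t. CLINT s|\<Gamma>. cos ((\<theta> + t *\<^sub>R axis j \<i>) \<bullet> s + p) *\<^sub>R g s) (at 0) =
      (CLINT s|\<Gamma>. ?c s *\<^sub>R Im (s $ j) *\<^sub>R g s)"
    using cos_integral_has_vector_derivative[OF g, of \<theta> "axis j \<i>" p]
    by (intro vector_derivative_at) (simp add: inner_axis' inner_complex_def)
  have int: "integrable \<Gamma> (\<lambda>s. ?c s *\<^sub>R Re (s $ j) *\<^sub>R g s)" "integrable \<Gamma> (\<lambda>s. ?c s *\<^sub>R Im (s $ j) *\<^sub>R g s)"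
    by (intro integrable_continuous_sphere continuous_intros g)+
  have "?c s *\<^sub>R (s $ j * g s) = ?c s *\<^sub>R Re (s $ j) *\<^sub>R g s + \<i> * (?c s *\<^sub>R Im (s $ j) *\<^sub>R g s)" for s
    by (simp add: complex_eq_iff algebra_simps)
  then show "dbar j (\<lambda>\<theta>. CLINT s|\<Gamma>. cos (\<theta> \<bullet> s + p) *\<^sub>R g s) \<theta> = (CLINT s|\<Gamma>. ?c s *\<^sub>R (s $ j * g s))"
    using int by (simp add: dbar_def ax 1 2 del: scaleR_scaleR mult_scaleR_right)
qed

text \<open>A transform that vanishes identically has vanishing derivatives in both directions 1 and
  i, so they may also be combined with the opposite sign. This yields the conjugate factors needed
  to complete a squared modulus.\<close>

lemma cos_integral_zero_cnj:
  fixes \<Gamma> :: "(complex^'n) measure"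
  assumes "sphere_measure \<Gamma>" and g: "continuous_on (sphere 0 1) g"
    and zero: "\<And>\<theta>. (CLINT s|\<Gamma>. cos (\<theta> \<bullet> s + p) *\<^sub>R g s) = 0"
  shows "(CLINT s|\<Gamma>. cos (\<theta> \<bullet> s + (p + pi/2)) *\<^sub>R (cnj (s $ j) * g s)) = 0"
proof -
  interpret sphere_measure \<Gamma> by fact
  let ?c = "\<lambda>s. cos (\<theta> \<bullet> s + (p + pi/2))"
  have int: "integrable \<Gamma> (\<lambda>s. ?c s *\<^sub>R Re (s $ j) *\<^sub>R g s)" "integrable \<Gamma> (\<lambda>s. ?c s *\<^sub>R Im (s $ j) *\<^sub>R g s)"
    by (intro integrable_continuous_sphere continuous_intros g)+
  have "(CLINT s|\<Gamma>. ?c s *\<^sub>R Re (s $ j) *\<^sub>R g s) = 0" "(CLINT s|\<Gamma>. ?c s *\<^sub>R Im (s $ j) *\<^sub>R g s) = 0"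
    using cos_integral_zero_deriv[OF g zero, of \<theta> "axis j 1"] cos_integral_zero_deriv[OF g zero, of \<theta> "axis j \<i>"]
    by (simp_all add: inner_axis' inner_complex_def)
  moreover have "?c s *\<^sub>R (cnj (s $ j) * g s) = ?c s *\<^sub>R Re (s $ j) *\<^sub>R g s - \<i> * (?c s *\<^sub>R Im (s $ j) *\<^sub>R g s)" for s
    by (simp add: complex_eq_iff algebra_simps)
  ultimately show ?thesis
    using int by (simp del: scaleR_scaleR mult_scaleR_right)
qed

lemma partial_deriv_cos_integral:
  fixes \<Gamma> :: "(real^'n) measure"
  assumes "sphere_measure \<Gamma>" and g: "continuous_on (sphere 0 1) g"
  shows "partial_deriv j (\<lambda>\<theta>. LINT s|\<Gamma>. cos (\<theta> \<bullet> s + p) *\<^sub>R g s) =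
    (\<lambda>\<theta>. LINT s|\<Gamma>. cos (\<theta> \<bullet> s + (p + pi/2)) *\<^sub>R (s $ j * g s))"
proof
  interpret sphere_measure \<Gamma> by fact
  fix \<theta> :: "real^'n"
  have ax: "axis j t = t *\<^sub>R axis j 1" for t :: real
    by (simp add: vec_eq_iff axis_def)
  show "partial_deriv j (\<lambda>\<theta>. LINT s|\<Gamma>. cos (\<theta> \<bullet> s + p) *\<^sub>R g s) \<theta> =
      (LINT s|\<Gamma>. cos (\<theta> \<bullet> s + (p + pi/2)) *\<^sub>R (s $ j * g s))"
    unfolding partial_deriv_def
  proof (rule DERIV_imp_deriv)
    show "((\<lambda>t. LINT s|\<Gamma>. cos ((\<theta> + axis j t) \<bullet> s + p) *\<^sub>R g s) has_real_derivative
        (LINT s|\<Gamma>. cos (\<theta> \<bullet> s + (p + pi/2)) *\<^sub>R (s $ j * g s))) (at 0)"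
      using cos_integral_has_vector_derivative[OF g, of \<theta> "axis j 1" p]
      by (subst ax) (simp add: has_real_derivative_iff_has_vector_derivative inner_axis')
  qed
qed

text \<open>The third derivatives of the Fourier transform are, up to sign, the sine transforms of
  $s_i s_j s_k\,d\Gamma$. If such a transform vanishes identically, differentiating it three more
  times and evaluating at the origin gives $\int |s_i s_j s_k|^2\,d\Gamma = 0$.\<close>

lemma AE_orthogonal_coordinates_complex:
  fixes \<Gamma> :: "(complex^'n) measure"
  assumes \<Gamma>: "sphere_measure \<Gamma>"
    and zero: "\<And>\<theta>. dbar i (dbar i (dbar j (\<lambda>\<eta>. complex_of_real (fourier_complex \<Gamma> \<eta>)))) \<theta> = 0"
  shows "AE s in \<Gamma>. s $ i * s $ j = 0"
proof -
  interpret sphere_measure \<Gamma> by fact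
  have F: "(\<lambda>\<eta>. complex_of_real (fourier_complex \<Gamma> \<eta>)) = (\<lambda>\<theta>. CLINT s|\<Gamma>. cos (\<theta> \<bullet> s + 0) *\<^sub>R 1)"
  proof
    fix \<eta> :: "complex^'n"
    have "Re (\<Sum>i\<in>UNIV. \<eta> $ i * cnj (s $ i)) = \<eta> \<bullet> s" for s
      by (simp add: inner_vec_def inner_complex_def)
    then show "complex_of_real (fourier_complex \<Gamma> \<eta>) = (CLINT s|\<Gamma>. cos (\<eta> \<bullet> s + 0) *\<^sub>R 1)"
      by (simp add: fourier_complex_def scaleR_conv_of_real)
  qed
  let ?g = "\<lambda>s::complex^'n. s $ i * (s $ i * (s $ j * 1))"
  have "(CLINT s|\<Gamma>. cos (\<theta> \<bullet> s + (0 + pi/2 + pi/2 + pi/2)) *\<^sub>R ?g s) = 0" for \<theta>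
    using zero[of \<theta>] unfolding F by (simp only: dbar_cos_integral[OF \<Gamma>] continuous_intros)
  \<comment> \<open>Conjugate factors for j, i and i are added in turn, so that s_i s_i s_j meets
    its own conjugate.\<close>
  from cos_integral_zero_cnj[OF \<Gamma> _ this, of _ j]
  have "(CLINT s|\<Gamma>. cos (\<theta> \<bullet> s + (0 + pi/2 + pi/2 + pi/2 + pi/2)) *\<^sub>R (cnj (s $ j) * ?g s)) = 0" for \<theta>
    by (simp add: continuous_intros)
  from cos_integral_zero_cnj[OF \<Gamma> _ this, of _ i]
  have "(CLINT s|\<Gamma>. cos (\<theta> \<bullet> s + (0 + pi/2 + pi/2 + pi/2 + pi/2 + pi/2)) *\<^sub>R
      (cnj (s $ i) * (cnj (s $ j) * ?g s))) = 0" for \<theta>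
    by (simp add: continuous_intros)
  from cos_integral_zero_cnj[OF \<Gamma> _ this, of 0 i]
  have "(CLINT s|\<Gamma>. cos (0 \<bullet> s + (0 + pi/2 + pi/2 + pi/2 + pi/2 + pi/2 + pi/2)) *\<^sub>R
      (cnj (s $ i) * (cnj (s $ i) * (cnj (s $ j) * ?g s)))) = 0"
    by (simp add: continuous_intros)
  moreover have "cos (0 \<bullet> s + (0 + pi/2 + pi/2 + pi/2 + pi/2 + pi/2 + pi/2)) *\<^sub>R
      (cnj (s $ i) * (cnj (s $ i) * (cnj (s $ j) * ?g s))) =
      complex_of_real (- (cmod (s $ i * (s $ i * s $ j)))\<^sup>2)" for s :: "complex^'n"
  proof -
    \<comment> \<open>Six quarter turns amount to 3 pi. The even number of derivatives makes the
      value at the origin a cosine of modulus 1 rather than 0.\<close>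
    have "cos (0 + pi/2 + pi/2 + pi/2 + pi/2 + pi/2 + pi/2) = - 1"
      using cos_periodic[of pi] by (simp add: algebra_simps)
    then show ?thesis
      by (simp add: complex_norm_square ac_simps del: of_real_power)
  qed
  ultimately have "(CLINT s|\<Gamma>. complex_of_real (- (cmod (s $ i * (s $ i * s $ j)))\<^sup>2)) = 0"
    by (simp only:)
  then have "(LINT s|\<Gamma>. (cmod (s $ i * (s $ i * s $ j)))\<^sup>2) = 0"
    unfolding integral_complex_of_real by simp
  moreover have "integrable \<Gamma> (\<lambda>s. (cmod (s $ i * (s $ i * s $ j)))\<^sup>2)"
    by (intro integrable_continuous_sphere continuous_intros)
  ultimately have "AE s in \<Gamma>. (cmod (s $ i * (s $ i * s $ j)))\<^sup>2 = 0"
    by (subst (asm) integral_nonneg_eq_0_iff_AE) auto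
  then show ?thesis by eventually_elim auto
qed

lemma AE_orthogonal_coordinates_real:
  fixes \<Gamma> :: "(real^'n) measure"
  assumes \<Gamma>: "sphere_measure \<Gamma>"
    and zero: "\<And>\<theta>. partial_deriv i (partial_deriv i (partial_deriv j (fourier_real \<Gamma>))) \<theta> = 0"
  shows "AE s in \<Gamma>. s $ i * s $ j = 0"
proof -
  interpret sphere_measure \<Gamma> by fact
  have F: "fourier_real \<Gamma> = (\<lambda>\<theta>. LINT s|\<Gamma>. cos (\<theta> \<bullet> s + 0) *\<^sub>R 1)"
    by (simp add: fun_eq_iff fourier_real_def inner_vec_def)
  let ?g = "\<lambda>s::real^'n. s $ i * (s $ i * (s $ j * 1))"
  have "(LINT s|\<Gamma>. cos (\<theta> \<bullet> s + (0 + pi/2 + pi/2 + pi/2)) *\<^sub>R ?g s) = 0" for \<theta>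
    using zero[of \<theta>] unfolding F by (simp only: partial_deriv_cos_integral[OF \<Gamma>] continuous_intros)
  \<comment> \<open>Over the reals the derivatives along j, i and i themselves complete the square
    of s_i s_i s_j.\<close>
  from cos_integral_zero_deriv[OF _ this, of _ "axis j 1"]
  have "(LINT s|\<Gamma>. cos (\<theta> \<bullet> s + (0 + pi/2 + pi/2 + pi/2 + pi/2)) *\<^sub>R (s $ j * ?g s)) = 0" for \<theta>
    by (simp add: continuous_intros inner_axis')
  from cos_integral_zero_deriv[OF _ this, of _ "axis i 1"]
  have "(LINT s|\<Gamma>. cos (\<theta> \<bullet> s + (0 + pi/2 + pi/2 + pi/2 + pi/2 + pi/2)) *\<^sub>R
      (s $ i * (s $ j * ?g s))) = 0" for \<theta>
    by (simp add: continuous_intros inner_axis')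
  from cos_integral_zero_deriv[OF _ this, of 0 "axis i 1"]
  have "(LINT s|\<Gamma>. cos (0 \<bullet> s + (0 + pi/2 + pi/2 + pi/2 + pi/2 + pi/2 + pi/2)) *\<^sub>R
      (s $ i * (s $ i * (s $ j * ?g s)))) = 0"
    by (simp add: continuous_intros inner_axis')
  moreover have "cos (0 \<bullet> s + (0 + pi/2 + pi/2 + pi/2 + pi/2 + pi/2 + pi/2)) *\<^sub>R
      (s $ i * (s $ i * (s $ j * ?g s))) = - (s $ i * (s $ i * s $ j))\<^sup>2" for s :: "real^'n"
  proof -
    have "cos (0 + pi/2 + pi/2 + pi/2 + pi/2 + pi/2 + pi/2) = - 1"
      using cos_periodic[of pi] by (simp add: algebra_simps)
    then show ?thesis by (simp add: power2_eq_square ac_simps)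
  qed
  ultimately have "(LINT s|\<Gamma>. (s $ i * (s $ i * s $ j))\<^sup>2) = 0"
    by simp
  moreover have "integrable \<Gamma> (\<lambda>s. (s $ i * (s $ i * s $ j))\<^sup>2)"
    by (intro integrable_continuous_sphere continuous_intros)
  ultimately have "AE s in \<Gamma>. (s $ i * (s $ i * s $ j))\<^sup>2 = 0"
    by (subst (asm) integral_nonneg_eq_0_iff_AE) auto
  then show ?thesis by eventually_elim auto
qed

section \<open>Additivity of the covariation\<close>

text \<open>If x_k is nonzero, the absence of zero divisors forces the other summands to be 0. This
  stands in for additivity of the signed power, which fails for general sums.\<close>

lemma apply_sum_single_support:
  fixes x :: "'i \<Rightarrow> 'c::semiring_no_zero_divisors" and f :: "'c \<Rightarrow> 'd::comm_monoid_add"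
  assumes "finite I" "f 0 = 0" and orth: "\<And>i j. i \<in> I \<Longrightarrow> j \<in> I \<Longrightarrow> i \<noteq> j \<Longrightarrow> x i * x j = 0"
  shows "f (\<Sum>i\<in>I. x i) = (\<Sum>i\<in>I. f (x i))"
proof (cases "\<exists>k\<in>I. x k \<noteq> 0")
  case True
  then obtain k where k: "k \<in> I" "x k \<noteq> 0" by blast
  then have "x i = 0" if "i \<in> I - {k}" for i
    using that orth[of k i] by auto
  then show ?thesis
    using \<open>finite I\<close> \<open>f 0 = 0\<close> k(1) by (simp add: sum.remove)
qed (simp add: \<open>f 0 = 0\<close>)

text \<open>Each covariation is by definition an integral against a different measure. Once all are
  written over the same \<Gamma>, additivity is an almost everywhere identity of integrands.\<close>

lemma covariation_complex_additive:
  fixes X :: "'a \<Rightarrow> complex^'n"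
  assumes \<Gamma>: "is_spectral_measure \<alpha> M X \<Gamma>" and \<alpha>: "1 < \<alpha>"
    and orth: "\<And>i j. i \<noteq> j \<Longrightarrow> AE s in \<Gamma>. s $ i * s $ j = 0"
  shows "covariation_complex \<alpha> M (\<lambda>\<omega>. X \<omega> $ i\<^sub>0) (\<lambda>\<omega>. \<Sum>j\<in>UNIV. \<theta> $ j * X \<omega> $ j) =
    (\<Sum>j\<in>UNIV. covariation_complex \<alpha> M (\<lambda>\<omega>. X \<omega> $ i\<^sub>0) (\<lambda>\<omega>. \<theta> $ j * X \<omega> $ j))"
proof -
  interpret sphere_measure \<Gamma> by (rule is_spectral_measure_sphere_measure[OF \<Gamma>])
  let ?h = "\<lambda>w. signed_power_complex w (\<alpha> - 1)"
  have lin: "linear (\<lambda>s::complex^'n. s $ k)" "linear (\<lambda>s. \<theta> $ k * s $ k)" for k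
    by (simp_all add: linear_iff algebra_simps)
  have int: "integrable \<Gamma> (\<lambda>s. s $ i\<^sub>0 * ?h (\<theta> $ j * s $ j))" for j
    by (intro integrable_signed_power_complex \<alpha> continuous_intros)
  have cov: "covariation_complex \<alpha> M (\<lambda>\<omega>. X \<omega> $ i\<^sub>0) (\<lambda>\<omega>. q (X \<omega>)) = (CLINT s|\<Gamma>. s $ i\<^sub>0 * ?h (q s))"
    if "linear q" for q
    by (rule covariation_complex_linear[OF \<Gamma> \<alpha> lin(1) that])
  \<comment> \<open>There are finitely many index pairs, so one null set serves for all of
    them.\<close>
  have "AE s in \<Gamma>. \<forall>i j. i \<noteq> j \<longrightarrow> s $ i * s $ j = 0"
    using orth by (intro eventually_all_finite) auto
  then have "AE s in \<Gamma>. s $ i\<^sub>0 * ?h (\<Sum>j\<in>UNIV. \<theta> $ j * s $ j) = (\<Sum>j\<in>UNIV. s $ i\<^sub>0 * ?h (\<theta> $ j * s $ j))"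
  proof eventually_elim
    case (elim s)
    then show ?case
      by (subst apply_sum_single_support[where f="?h"])
        (auto simp: signed_power_complex_def sum_distrib_left)
  qed
  moreover have "(\<lambda>s. s $ i\<^sub>0 * ?h (\<Sum>j\<in>UNIV. \<theta> $ j * s $ j)) \<in> borel_measurable \<Gamma>"
    by (intro borel_measurable_integrable integrable_signed_power_complex \<alpha> continuous_intros)
  ultimately have "(CLINT s|\<Gamma>. s $ i\<^sub>0 * ?h (\<Sum>j\<in>UNIV. \<theta> $ j * s $ j)) =
      (CLINT s|\<Gamma>. (\<Sum>j\<in>UNIV. s $ i\<^sub>0 * ?h (\<theta> $ j * s $ j)))"
    using int by (intro integral_cong_AE borel_measurable_sum) auto
  also have "\<dots> = (\<Sum>j\<in>UNIV. CLINT s|\<Gamma>. s $ i\<^sub>0 * ?h (\<theta> $ j * s $ j))"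
    by (rule Bochner_Integration.integral_sum[OF int])
  finally show ?thesis
    using cov[of "\<lambda>s. \<Sum>j\<in>UNIV. \<theta> $ j * s $ j"] cov[OF lin(2)]
    by (simp add: lin linear_compose_sum)
qed

lemma covariation_real_additive:
  fixes X :: "'a \<Rightarrow> real^'n"
  assumes \<Gamma>: "is_spectral_measure \<alpha> M X \<Gamma>" and \<alpha>: "1 < \<alpha>"
    and orth: "\<And>i j. i \<noteq> j \<Longrightarrow> AE s in \<Gamma>. s $ i * s $ j = 0"
  shows "covariation_real \<alpha> M (\<lambda>\<omega>. X \<omega> $ i\<^sub>0) (\<lambda>\<omega>. \<Sum>j\<in>UNIV. \<theta> $ j * X \<omega> $ j) =
    (\<Sum>j\<in>UNIV. covariation_real \<alpha> M (\<lambda>\<omega>. X \<omega> $ i\<^sub>0) (\<lambda>\<omega>. \<theta> $ j * X \<omega> $ j))"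
proof -
  interpret sphere_measure \<Gamma> by (rule is_spectral_measure_sphere_measure[OF \<Gamma>])
  let ?h = "\<lambda>w. signed_power_real w (\<alpha> - 1)"
  have lin: "linear (\<lambda>s::real^'n. s $ k)" "linear (\<lambda>s. \<theta> $ k * s $ k)" for k
    by (simp_all add: linear_iff algebra_simps)
  have int: "integrable \<Gamma> (\<lambda>s. s $ i\<^sub>0 * ?h (\<theta> $ j * s $ j))" for j
    unfolding mult_signed_power_real by (intro integrable_inner_powr \<alpha> continuous_intros)
  have cov: "covariation_real \<alpha> M (\<lambda>\<omega>. X \<omega> $ i\<^sub>0) (\<lambda>\<omega>. q (X \<omega>)) = (LINT s|\<Gamma>. s $ i\<^sub>0 * ?h (q s))"
    if "linear q" for q
    by (rule covariation_real_linear[OF \<Gamma> \<alpha> lin(1) that])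
  have "AE s in \<Gamma>. \<forall>i j. i \<noteq> j \<longrightarrow> s $ i * s $ j = 0"
    using orth by (intro eventually_all_finite) auto
  then have "AE s in \<Gamma>. s $ i\<^sub>0 * ?h (\<Sum>j\<in>UNIV. \<theta> $ j * s $ j) = (\<Sum>j\<in>UNIV. s $ i\<^sub>0 * ?h (\<theta> $ j * s $ j))"
  proof eventually_elim
    case (elim s)
    then show ?case
      by (subst apply_sum_single_support[where f="?h"])
        (auto simp: signed_power_real_def sum_distrib_left)
  qed
  moreover have "(\<lambda>s. s $ i\<^sub>0 * ?h (\<Sum>j\<in>UNIV. \<theta> $ j * s $ j)) \<in> borel_measurable \<Gamma>"
    unfolding mult_signed_power_real
    by (intro borel_measurable_integrable integrable_inner_powr \<alpha> continuous_intros)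
  ultimately have "(LINT s|\<Gamma>. s $ i\<^sub>0 * ?h (\<Sum>j\<in>UNIV. \<theta> $ j * s $ j)) =
      (LINT s|\<Gamma>. (\<Sum>j\<in>UNIV. s $ i\<^sub>0 * ?h (\<theta> $ j * s $ j)))"
    using int by (intro integral_cong_AE borel_measurable_sum) auto
  also have "\<dots> = (\<Sum>j\<in>UNIV. LINT s|\<Gamma>. s $ i\<^sub>0 * ?h (\<theta> $ j * s $ j))"
    by (rule Bochner_Integration.integral_sum[OF int])
  finally show ?thesis
    using cov[of "\<lambda>s. \<Sum>j\<in>UNIV. \<theta> $ j * s $ j"] cov[OF lin(2)]
    by (simp add: lin linear_compose_sum)
qed

theorem theorem2p1:
  fixes \<alpha> :: real and M :: "'a measure"
    and X :: "'a \<Rightarrow> complex^'n" and Y :: "'a \<Rightarrow> real^'n"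
  assumes "prob_space M" and "1 < \<alpha>" and "\<alpha> < 2"
  shows
    "(symmetric_stable \<alpha> M X \<and>
      (\<forall>i j k. \<not> (i = j \<and> j = k) \<longrightarrow>
        (\<forall>\<theta>. dbar i (dbar j (dbar k
            (\<lambda>\<eta>. complex_of_real (fourier_complex (spectral_measure \<alpha> M X) \<eta>)))) \<theta> = 0))
      \<longrightarrow>
      (\<forall>i\<^sub>0. \<forall>\<theta> :: complex^'n.
        covariation_complex \<alpha> M (\<lambda>\<omega>. X \<omega> $ i\<^sub>0) (\<lambda>\<omega>. \<Sum>j\<in>UNIV. \<theta> $ j * X \<omega> $ j) =
        (\<Sum>j\<in>UNIV. covariation_complex \<alpha> M (\<lambda>\<omega>. X \<omega> $ i\<^sub>0) (\<lambda>\<omega>. \<theta> $ j * X \<omega> $ j))))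
     \<and>
     (symmetric_stable \<alpha> M Y \<and>
      (\<forall>i j k. \<not> (i = j \<and> j = k) \<longrightarrow>
        (\<forall>\<theta>. partial_deriv i (partial_deriv j (partial_deriv k
            (fourier_real (spectral_measure \<alpha> M Y)))) \<theta> = 0))
      \<longrightarrow>
      (\<forall>i\<^sub>0. \<forall>\<theta> :: real^'n.
        covariation_real \<alpha> M (\<lambda>\<omega>. Y \<omega> $ i\<^sub>0) (\<lambda>\<omega>. \<Sum>j\<in>UNIV. \<theta> $ j * Y \<omega> $ j) =
        (\<Sum>j\<in>UNIV. covariation_real \<alpha> M (\<lambda>\<omega>. Y \<omega> $ i\<^sub>0) (\<lambda>\<omega>. \<theta> $ j * Y \<omega> $ j))))"
proof (intro conjI impI allI; elim conjE)
  fix i\<^sub>0 and \<theta> :: "complex^'n"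
  let ?\<Gamma> = "spectral_measure \<alpha> M X"
  assume "symmetric_stable \<alpha> M X"
    and zero: "\<forall>i j k. \<not> (i = j \<and> j = k) \<longrightarrow>
      (\<forall>\<theta>. dbar i (dbar j (dbar k (\<lambda>\<eta>. complex_of_real (fourier_complex ?\<Gamma> \<eta>)))) \<theta> = 0)"
  then have \<Gamma>: "is_spectral_measure \<alpha> M X ?\<Gamma>"
    unfolding symmetric_stable_def by (blast intro: is_spectral_measure_spectral_measure)
  show "covariation_complex \<alpha> M (\<lambda>\<omega>. X \<omega> $ i\<^sub>0) (\<lambda>\<omega>. \<Sum>j\<in>UNIV. \<theta> $ j * X \<omega> $ j) =
      (\<Sum>j\<in>UNIV. covariation_complex \<alpha> M (\<lambda>\<omega>. X \<omega> $ i\<^sub>0) (\<lambda>\<omega>. \<theta> $ j * X \<omega> $ j))"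
    \<comment> \<open>For i \<noteq> j the triple (i, i, j) is not constant, so the assumption on
      third derivatives applies to it.\<close>
    using zero
    by (intro covariation_complex_additive[OF \<Gamma> \<open>1 < \<alpha>\<close>]
        AE_orthogonal_coordinates_complex[OF is_spectral_measure_sphere_measure[OF \<Gamma>]]) blast
next
  fix i\<^sub>0 and \<theta> :: "real^'n"
  let ?\<Gamma> = "spectral_measure \<alpha> M Y"
  assume "symmetric_stable \<alpha> M Y"
    and zero: "\<forall>i j k. \<not> (i = j \<and> j = k) \<longrightarrow>
      (\<forall>\<theta>. partial_deriv i (partial_deriv j (partial_deriv k (fourier_real ?\<Gamma>))) \<theta> = 0)"
  then have \<Gamma>: "is_spectral_measure \<alpha> M Y ?\<Gamma>"
    unfolding symmetric_stable_def by (blast intro: is_spectral_measure_spectral_measure)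
  show "covariation_real \<alpha> M (\<lambda>\<omega>. Y \<omega> $ i\<^sub>0) (\<lambda>\<omega>. \<Sum>j\<in>UNIV. \<theta> $ j * Y \<omega> $ j) =
      (\<Sum>j\<in>UNIV. covariation_real \<alpha> M (\<lambda>\<omega>. Y \<omega> $ i\<^sub>0) (\<lambda>\<omega>. \<theta> $ j * Y \<omega> $ j))"
    using zero
    by (intro covariation_real_additive[OF \<Gamma> \<open>1 < \<alpha>\<close>]
        AE_orthogonal_coordinates_real[OF is_spectral_measure_sphere_measure[OF \<Gamma>]]) blast
qed

end
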